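(* Let $F:[0,\infty)\to\mathbb{R}$ be $C^{1,1}$ with $F'(0)=0$, let $\Sigma=\{(w,F(|w|)):w\in\mathbb{R}^2\}\subset\mathbb{R}^3$, and set $M:=\max\{1,\limsup_{t\downarrow0}|F'(t)|/t\}$. There exist $\epsilon>0$, $L=L(M)>1$ (depending only on $M$), and a neighborhood $U\subset\Sigma$ of $(0,0,F(0))$ such that $(U,d_{\mathbb{H}})$ $L$-bi-Lipschitz embeds in $\mathbb{R}^4$.
   Context: For $w=(x,y,z)$, $w'=(x',y',z')$, $d_{\mathbb{H}}(w,w')=|x-x'|+|y-y'|+|z-z'+\tfrac12(xy'-x'y)|^{1/2}$. $(A,d_{\mathbb{H}})$ $L$-bi-Lipschitz embeds in $\mathbb{R}^4$ if there is $f:A\to\mathbb{R}^4$ with $L^{-1}d_{\mathbb{H}}(a,b)\le|f(a)-f(b)|\le Ld_{\mathbb{H}}(a,b)$ for all $a,b\in A$. *)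

theory Defs
  imports "HOL-Analysis.Analysis" "HOL-Library.Extended_Real"
begin

definition dH :: "real \<times> real \<times> real \<Rightarrow> real \<times> real \<times> real \<Rightarrow> real" where
  "dH w w' = (case w of (x, y, z) \<Rightarrow> case w' of (x', y', z') \<Rightarrow>
      \<bar>x - x'\<bar> + \<bar>y - y'\<bar> + sqrt \<bar>z - z' + (1/2) * (x * y' - x' * y)\<bar>)"

definition biLip_embeds_R4 :: "(real \<times> real \<times> real) set \<Rightarrow> real \<Rightarrow> bool" where
  "biLip_embeds_R4 A L \<longleftrightarrow> (\<exists>f :: real \<times> real \<times> real \<Rightarrow> real^4.
      \<forall>a\<in>A. \<forall>b\<in>A. dH a b / L \<le> dist (f a) (f b) \<and> dist (f a) (f b) \<le> L * dH a b)"

definition radial_graph :: "(real \<Rightarrow> real) \<Rightarrow> (real \<times> real \<times> real) set" where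
  "radial_graph F = {(x, y, F (sqrt (x\<^sup>2 + y\<^sup>2))) | x y. True}"

end

theory Submission
  imports Defs
begin

text \<open>
  In polar coordinates the horizontal curves of the surface are the graphs \<open>\<theta> = \<phi> + g r\<close> with
  \<open>g' r = 2 * F' r / r\<^sup>2\<close>. Where \<open>\<bar>F' t\<bar> \<le> N * t\<close>, moving along such a curve costs a comparable
  Heisenberg distance, while turning by the angle \<open>\<delta>\<close> at radius \<open>r\<close> costs about \<open>r * sqrt \<bar>\<delta>\<bar>\<close>. In the
  coordinates \<open>(r, \<phi>)\<close> the surface is therefore, with constants depending only on \<open>N\<close>, bi-Lipschitz to a
  cone over the circle with the square root of its metric. An iterated helix \<open>h\<close> embeds this snowflaked
  circle in three-dimensional space, and \<open>(r, \<phi>) \<mapsto> (r, r * h \<phi>)\<close> embeds the cone in four dimensions.\<close>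

section \<open>A snowflake embedding of the circle in three-space\<close>

lemma norm_cis_diff: "norm (cis s - cis t) = 2 * \<bar>sin ((s - t) / 2)\<bar>"
proof -
  have "cis s - cis t = cis t * (cis (s - t) - 1)"
    by (simp add: right_diff_distrib cis_mult)
  then show ?thesis
    using dist_exp_i_1[of "s - t"] by (simp add: norm_mult cis_conv_exp)
qed

lemma norm_cis_diff_le: "norm (cis s - cis t) \<le> \<bar>s - t\<bar>"
  using abs_sin_x_le_abs_x[of "(s - t) / 2"] by (simp add: norm_cis_diff)

text \<open>First-order Taylor remainder of the exponential on the imaginary axis; it measures how
  far a chord deviates from the tangent.\<close>

lemma norm_cis_taylor: "norm (cis s - cis t - of_real (s - t) * (\<i> * cis s)) \<le> (s - t)\<^sup>2"
proof -
  have "cis s - cis t - of_real (s - t) * (\<i> * cis s)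
      = - cis s * (exp (\<i> * of_real (t - s)) - (\<Sum>k\<le>1. (\<i> * of_real (t - s)) ^ k / fact k))"
    by (simp add: cis_conv_exp algebra_simps flip: exp_add)
  also have "norm \<dots> \<le> (s - t)\<^sup>2"
    using Taylor_exp[of "\<i> * of_real (t - s)" 1]
    unfolding norm_mult norm_of_real
    by (subst power2_commute) (simp add: norm_mult power2_eq_square del: of_real_diff)
  finally show ?thesis .
qed

text \<open>\<open>16/5\<close> is a rational number just above pi, so all angles reduced modulo a
  full turn are covered. The cubic remainder of sine leaves the factor 1 - (8/5)^2/6 = 43/75, and
  half of it exceeds 2/7.\<close>

lemma abs_sin_half_ge:
  fixes x :: real
  assumes "\<bar>x\<bar> \<le> 16/5"
  shows "2/7 * \<bar>x\<bar> \<le> \<bar>sin (x / 2)\<bar>"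
proof -
  define y where "y = x / 2"
  have y: "\<bar>x\<bar> = 2 * \<bar>y\<bar>"
    by (simp add: y_def)
  have expansion: "(\<Sum>m<3. sin_coeff m * y ^ m) = y"
    by (simp add: sin_coeff_def numeral_3_eq_3)
  have "inverse (fact 3) = (1 / 6 :: real)"
    by (simp add: fact_numeral)
  then have "\<bar>sin y - y\<bar> \<le> \<bar>y\<bar> ^ 3 / 6"
    using Maclaurin_sin_bound[of y 3] unfolding expansion by (simp only:)
  moreover have "\<bar>y\<bar> ^ 3 = \<bar>y\<bar> * \<bar>y\<bar>\<^sup>2"
    by (simp add: power3_eq_cube power2_eq_square)
  moreover have "\<bar>y\<bar> * \<bar>y\<bar>\<^sup>2 \<le> \<bar>y\<bar> * (8/5)\<^sup>2"
    using assms by (intro mult_left_mono power_mono) (auto simp: y)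
  moreover have "\<bar>y\<bar> * (8/5)\<^sup>2 = 64/25 * \<bar>y\<bar>"
    by (simp add: power2_eq_square)
  ultimately have "43/75 * \<bar>y\<bar> \<le> \<bar>sin y\<bar>"
    by linarith
  then show ?thesis
    unfolding y y_def[symmetric] by linarith
qed

text \<open>
  Sends the third basis vector of \<open>\<complex> \<times> \<real>\<close> to the tangent of the unit circle at \<open>cis t\<close> and the
  horizontal plane to the normal plane of the circle there.\<close>
definition tangent_frame :: "real \<Rightarrow> complex \<times> real \<Rightarrow> complex \<times> real" where
  "tangent_frame t p = (cis t * Complex (Re (fst p)) (snd p), Im (fst p))"

lemma linear_tangent_frame: "linear (tangent_frame t)"
  by (rule linearI) (auto simp: tangent_frame_def complex_eq_iff algebra_simps)

lemmas tangent_frame_add = linear_add[OF linear_tangent_frame]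
lemmas tangent_frame_diff = linear_diff[OF linear_tangent_frame]

lemma norm_tangent_frame [simp]: "norm (tangent_frame t p) = norm p"
  by (cases p) (simp add: tangent_frame_def norm_Pair norm_mult cmod_power2)

text \<open>The last coordinate is the same in both frames and cancels, so only the rotation by
  \<open>cis\<close> contributes.\<close>

lemma norm_tangent_frame_diff: "norm (tangent_frame s p - tangent_frame t p) \<le> \<bar>s - t\<bar> * norm p"
proof -
  have "norm (tangent_frame s p - tangent_frame t p)
      = norm (cis s - cis t) * cmod (Complex (Re (fst p)) (snd p))"
    unfolding tangent_frame_def by (simp add: norm_Pair norm_mult left_diff_distrib[symmetric])
  moreover have "cmod (Complex (Re (fst p)) (snd p)) \<le> norm p"
    by (cases p) (simp add: norm_Pair cmod_def)
  then have "norm (cis s - cis t) * cmod (Complex (Re (fst p)) (snd p)) \<le> \<bar>s - t\<bar> * norm p"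
    by (intro mult_mono norm_cis_diff_le) auto
  ultimately show ?thesis by simp
qed

lemma surj_tangent_frame: obtains p where "tangent_frame t p = q"
proof
  let ?w = "cis (- t) * fst q"
  have "cis t * ?w = fst q"
    by (subst mult.assoc[symmetric]) (simp add: cis_mult)
  then show "tangent_frame t (Complex (Re ?w) (snd q), Im ?w) = q"
    by (simp only: tangent_frame_def fst_conv snd_conv complex.sel complex.collapse prod.collapse)
qed

text \<open>
  An iterated helix: each circle of the curve is the axis of a coil that is 100 times thinner and
  winds 10000 times faster, in the planes normal to that circle.\<close>
primrec helix_approx :: "nat \<Rightarrow> real \<Rightarrow> complex \<times> real" where
  "helix_approx 0 t = 0"
| "helix_approx (Suc n) t = (cis t, 0) + (1/100) *\<^sub>R tangent_frame t (helix_approx n (10000 * t))"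

text \<open>Each difference of consecutive approximants is 1/100 of an isometric image of the
  preceding difference at the rescaled parameter.\<close>

lemma norm_helix_approx_Suc: "norm (helix_approx (Suc n) t - helix_approx n t) \<le> (1/100) ^ n"
proof (induction n arbitrary: t)
  case 0
  show ?case by (simp add: norm_Pair linear_0[OF linear_tangent_frame])
next
  case (Suc n)
  have "helix_approx (Suc (Suc n)) t - helix_approx (Suc n) t
      = (1/100) *\<^sub>R tangent_frame t (helix_approx (Suc n) (10000 * t) - helix_approx n (10000 * t))"
    unfolding helix_approx.simps(2)[of "Suc n" t] helix_approx.simps(2)[of n t]
    by (simp only: tangent_frame_diff scaleR_diff_right) simp
  then show ?case
    using Suc.IH[of "10000 * t"] by (simp del: helix_approx.simps)
qed

text \<open>\<open>100/99\<close> is the fixed point of x = 1 + x/100, so the recursion preserves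
  the bound.\<close>

lemma norm_helix_approx: "norm (helix_approx n t) \<le> 100/99"
proof (induction n arbitrary: t)
  case (Suc n)
  have "norm (helix_approx (Suc n) t)
      \<le> norm (cis t, 0 :: real) + norm ((1/100) *\<^sub>R tangent_frame t (helix_approx n (10000 * t)))"
    unfolding helix_approx.simps by (rule norm_triangle_ineq)
  also have "\<dots> = 1 + norm (helix_approx n (10000 * t)) / 100"
    by (simp add: norm_Pair)
  finally show ?case
    using Suc[of "10000 * t"] by linarith
qed simp

lemma helix_approx_periodic: "helix_approx n (t + 2 * pi * of_int m) = helix_approx n t"
proof (induction n arbitrary: t m)
  case (Suc n)
  have "cis (t + 2 * pi * of_int m) = cis t"
    using cis_multiple_2pi[of "of_int m"] by (simp flip: cis_mult)
  \<comment> \<open>The winding ratio is an integer, so a full turn of the axis is a whole number of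
    turns of the coil.\<close>
  moreover have "10000 * (t + 2 * pi * of_int m) = 10000 * t + 2 * pi * of_int (10000 * m)"
    by (simp add: algebra_simps)
  ultimately show ?case
    by (simp only: helix_approx.simps tangent_frame_def Suc)
qed simp

lemma convergent_helix_approx: "convergent (\<lambda>n. helix_approx n t)"
proof -
  have "summable (\<lambda>n. helix_approx (Suc n) t - helix_approx n t)"
    by (rule summable_comparison_test'[OF _ norm_helix_approx_Suc]) (simp add: summable_geometric)
  then have "convergent (\<lambda>n. \<Sum>i<n. helix_approx (Suc i) t - helix_approx i t)"
    by (simp only: summable_iff_convergent)
  then show ?thesis
    unfolding sum_lessThan_telescope[of "\<lambda>i. helix_approx i t"] by simp
qed

section \<open>The limit curve and its self-similarity\<close>

definition helix :: "real \<Rightarrow> complex \<times> real" where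
  "helix t = lim (\<lambda>n. helix_approx n t)"

lemma helix_approx_tendsto: "(\<lambda>n. helix_approx n t) \<longlonglongrightarrow> helix t"
  unfolding helix_def using convergent_helix_approx by (simp add: convergent_LIMSEQ_iff)

lemma helix_rec: "helix t = (cis t, 0) + (1/100) *\<^sub>R tangent_frame t (helix (10000 * t))"
proof (rule LIMSEQ_unique)
  show "(\<lambda>n. helix_approx (Suc n) t) \<longlonglongrightarrow> helix t"
    using helix_approx_tendsto by (rule LIMSEQ_Suc)
  show "(\<lambda>n. helix_approx (Suc n) t)
      \<longlonglongrightarrow> (cis t, 0) + (1/100) *\<^sub>R tangent_frame t (helix (10000 * t))"
    unfolding helix_approx.simps
    by (intro tendsto_intros bounded_linear.tendsto[OF linear_tangent_frame[THEN linear_conv_bounded_linear[THEN iffD1]]]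
      helix_approx_tendsto)
qed

lemma norm_helix: "norm (helix t) \<le> 100/99"
  by (rule LIMSEQ_le_const2[OF tendsto_norm[OF helix_approx_tendsto]]) (use norm_helix_approx in blast)

lemma helix_periodic: "helix (t + 2 * pi * of_int m) = helix t"
  by (simp only: helix_def helix_approx_periodic)

text \<open>One magnification step. In the frame at \<open>t\<close>, the displacement of the outer
  circle is nearly tangential, hence nearly a multiple of the third basis vector. The old error
  \<open>e\<close>, the curvature of the circle and the turning of the frame are collected in the
  deviation of \<open>e'\<close> from that vector.\<close>

lemma helix_diff_rescale:
  assumes e: "norm e \<le> 27/2500 * \<bar>t - s\<bar>" and close: "\<bar>t - s\<bar> \<le> 1/20"
  obtains e' where
    "norm (helix t - helix s + e) = norm (helix (10000 * t) - helix (10000 * s) + e') / 100"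
    "norm (e' - (0, 100 * (t - s))) \<le> 8 * \<bar>t - s\<bar>"
proof -
  let ?a = "helix (10000 * t)" and ?b = "helix (10000 * s)"
  let ?v = "(cis t, 0 :: real) - (cis s, 0)"
  let ?w = "tangent_frame t ?b - tangent_frame s ?b"
  obtain e' where e': "tangent_frame t e' = 100 *\<^sub>R e + 100 *\<^sub>R ?v + ?w"
    by (rule surj_tangent_frame)
  have "tangent_frame t (?a - ?b + e') = 100 *\<^sub>R (helix t - helix s + e)"
    unfolding tangent_frame_add tangent_frame_diff e'
    by (subst helix_rec[of t], subst helix_rec[of s]) (simp add: algebra_simps)
  then have "norm (?a - ?b + e') = 100 * norm (helix t - helix s + e)"
    by (metis norm_tangent_frame norm_scaleR abs_numeral)
  moreover have "norm (e' - (0, 100 * (t - s))) \<le> 8 * \<bar>t - s\<bar>"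
  proof -
    let ?u = "?v - ((t - s) *\<^sub>R (\<i> * cis t), 0)"
    have "tangent_frame t (0, 100 * (t - s)) = 100 *\<^sub>R ((t - s) *\<^sub>R (\<i> * cis t), 0)"
      by (simp add: tangent_frame_def complex_eq_iff)
    then have "tangent_frame t (e' - (0, 100 * (t - s))) = 100 *\<^sub>R e + 100 *\<^sub>R ?u + ?w"
      unfolding tangent_frame_diff e' by (simp only: scaleR_diff_right) simp
    then have "norm (e' - (0, 100 * (t - s))) \<le> 100 * norm e + 100 * norm ?u + norm ?w"
      by (metis (no_types) norm_tangent_frame norm_scaleR abs_numeral norm_triangle_le norm_triangle_ineq order_refl add_mono)
    moreover have "norm ?u \<le> (t - s)\<^sup>2"
      using norm_cis_taylor[of t s] by (simp add: norm_Pair scaleR_conv_of_real del: of_real_diff)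
    moreover have "(t - s)\<^sup>2 \<le> 1/20 * \<bar>t - s\<bar>"
      using mult_right_mono[OF close, of "\<bar>t - s\<bar>"] by (simp add: power2_eq_square)
    moreover have "norm ?w \<le> \<bar>t - s\<bar> * (100/99)"
      by (rule order_trans[OF norm_tangent_frame_diff mult_left_mono[OF norm_helix]]) simp
    \<comment> \<open>Old error, curvature and turning of the frame contribute 27/25, 5 and 100/99
      times the gap, less than 8 in total.\<close>
    moreover have "a \<le> 8 * y" if "a \<le> 100 * b + 100 * c + d" "c \<le> q" "q \<le> 1/20 * y"
      "d \<le> y * (100/99)" "b \<le> 27/2500 * y" "0 \<le> y" for a b c d q y :: real
      using that by linarith
    ultimately show ?thesis
      using e abs_ge_zero by blast
  qed
  ultimately show thesis
    by (intro that[of e']) auto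
qed

text \<open>
  Magnified by \<open>100 ^ n\<close>, the coarser circles displace the points mainly along the third axis, with a
  pitch of \<open>2 * pi / 100\<close> per turn, while the finer coils have diameter about \<open>2 / 100\<close>.\<close>
lemma helix_diff_magnify:
  assumes "10000 ^ n * \<bar>t - s\<bar> \<le> 500"
  shows "\<exists>e. norm (helix t - helix s)
        = norm (helix (10000 ^ n * t) - helix (10000 ^ n * s) + e) / 100 ^ n
      \<and> norm e \<le> 27/2500 * (10000 ^ n * \<bar>t - s\<bar>)
      \<and> (n > 0 \<longrightarrow> norm (e - (0, 1/100 * (10000 ^ n * (t - s)))) \<le> 1/1250 * (10000 ^ n * \<bar>t - s\<bar>))"
  using assms
proof (induction n)
  case 0
  show ?case by (intro exI[of _ 0]) simp
next
  case (Suc n)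
  let ?N = "10000 ^ n :: real"
  have y: "?N * \<bar>t - s\<bar> = \<bar>?N * t - ?N * s\<bar>"
    by (simp add: abs_mult flip: right_diff_distrib)
  \<comment> \<open>The threshold 500 is 10000 times 1/20, the range in which one magnification step
    is available.\<close>
  have close: "\<bar>?N * t - ?N * s\<bar> \<le> 1/20"
    using Suc.prems unfolding y[symmetric] power_Suc mult.assoc by linarith
  obtain e where e: "norm (helix t - helix s) = norm (helix (?N * t) - helix (?N * s) + e) / 100 ^ n"
    "norm e \<le> 27/2500 * \<bar>?N * t - ?N * s\<bar>"
    using Suc.IH close unfolding y by auto
  obtain e' where e': "norm (helix (?N * t) - helix (?N * s) + e)
      = norm (helix (10000 * (?N * t)) - helix (10000 * (?N * s)) + e') / 100"
    "norm (e' - (0, 100 * (?N * t - ?N * s))) \<le> 8 * \<bar>?N * t - ?N * s\<bar>"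
    using helix_diff_rescale[OF e(2) close] by metis
  have "norm e' \<le> norm (e' - (0, 100 * (?N * t - ?N * s))) + norm (0 :: complex, 100 * (?N * t - ?N * s))"
    using norm_triangle_ineq[of "e' - (0, 100 * (?N * t - ?N * s))" "(0, 100 * (?N * t - ?N * s))"]
    unfolding diff_add_cancel .
  also have "norm (0 :: complex, 100 * (?N * t - ?N * s)) = 100 * \<bar>?N * t - ?N * s\<bar>"
    unfolding norm_Pair1 real_norm_def abs_mult by simp
  \<comment> \<open>The displacement 100 and the deviation 8 add up to 108; in the new unit, 10000
    times larger, this is 27/2500, so the bound reproduces itself.\<close>
  finally have "norm e' \<le> 27/2500 * (10000 * \<bar>?N * t - ?N * s\<bar>)"
    using e'(2) by simp
  moreover have "10000 ^ Suc n * \<bar>t - s\<bar> = 10000 * \<bar>?N * t - ?N * s\<bar>"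
    by (simp flip: y)
  moreover have "1/100 * (10000 ^ Suc n * (t - s)) = 100 * (?N * t - ?N * s)"
    by (simp add: algebra_simps)
  ultimately show ?case
    using e(1) e' by (intro exI[of _ e']) (simp add: mult.assoc)
qed

section \<open>The two-sided square-root estimate for the helix\<close>

lemma helix_diff_eq:
  "helix t - helix s = (cis t - cis s, 0)
    + (1/100) *\<^sub>R (tangent_frame t (helix (10000 * t)) - tangent_frame s (helix (10000 * s)))"
  by (subst helix_rec[of t], subst helix_rec[of s]) (simp add: algebra_simps)

text \<open>Finer coils move the points by at most about 2/100. For gaps up to \<open>16/5\<close>
  the chord of the unit circle dominates this. For larger gaps the chord may vanish, since the gap
  may be a multiple of a full turn, and the third coordinate of \<open>e\<close> separates the
  points instead.\<close>

lemma helix_diff_lower: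
  assumes large: "\<bar>t - s\<bar> \<ge> 1/20" and e: "norm e \<le> 27/2500 * \<bar>t - s\<bar>"
    and dir: "\<bar>t - s\<bar> \<le> 16/5 \<or> norm (e - (0, 1/100 * (t - s))) \<le> 1/1250 * \<bar>t - s\<bar>"
  shows "norm (helix t - helix s + e) \<ge> 1/200"
proof -
  define q where "q = (1/100) *\<^sub>R (tangent_frame t (helix (10000 * t)) - tangent_frame s (helix (10000 * s)))"
  have "norm q = norm (tangent_frame t (helix (10000 * t)) - tangent_frame s (helix (10000 * s))) / 100"
    by (simp add: q_def)
  also have "\<dots> \<le> (100/99 + 100/99) / 100"
    by (rule divide_right_mono[OF order_trans[OF norm_triangle_ineq4 add_mono]])
       (simp_all only: norm_tangent_frame norm_helix zero_le_numeral)
  finally have q: "norm q \<le> 203/10000" by simp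
  have d: "helix t - helix s + e = (cis t - cis s, 0) + q + e"
    by (simp add: helix_diff_eq q_def)
  show ?thesis
  proof (cases "\<bar>t - s\<bar> \<le> 16/5")
    case True
    have "4/7 * \<bar>t - s\<bar> \<le> norm (cis t - cis s, 0 :: real)"
      using abs_sin_half_ge[OF True] by (simp only: norm_Pair2 norm_cis_diff)
    also have "\<dots> = norm ((helix t - helix s + e) - q - e)"
      by (simp add: d)
    also have "\<dots> \<le> norm (helix t - helix s + e) + norm q + norm e"
      by (rule order_trans[OF norm_triangle_ineq4 add_right_mono[OF norm_triangle_ineq4]])
    finally show ?thesis using large e q by simp
  next
    case False
    \<comment> \<open>The chord has no third coordinate; there \<open>e\<close> contributes at least
      (1/100 - 1/1250) * 16/5 > 0.029, against at most 0.0203 from \<open>q\<close>.\<close>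
    have snd_le: "\<bar>snd p\<bar> \<le> norm p" for p :: "complex \<times> real"
      using norm_snd_le[of "snd p" "fst p"] by simp
    have "\<bar>snd e - 1/100 * (t - s)\<bar> \<le> 1/1250 * \<bar>t - s\<bar>"
      using dir False snd_le[of "e - (0, 1/100 * (t - s))"] by simp
    moreover have "\<bar>snd q + snd e\<bar> \<le> norm (helix t - helix s + e)"
      using snd_le[of "(cis t - cis s, 0) + q + e"] by (simp add: d)
    moreover note snd_le[of q]
    moreover have "1/200 \<le> N" if "\<bar>c - 1/100 * y\<bar> \<le> 1/1250 * \<bar>y\<bar>" "\<bar>b + c\<bar> \<le> N" "\<bar>b\<bar> \<le> Q"
      "\<not> \<bar>y\<bar> \<le> 16/5" "Q \<le> 203/10000" for b c y N Q :: real
      using that by argo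
    ultimately show ?thesis using False q by blast
  qed
qed

text \<open>Magnify just until the parameter gap reaches 1/20; by minimality of \<open>n\<close> it
  is then at most 500. At that scale the distance lies between two constants. Since parameters scale
  by 10000 and distances by 100, this is a square-root law.\<close>

lemma helix_snowflake_near:
  assumes "t \<noteq> s" "\<bar>t - s\<bar> \<le> 16/5"
  shows "1/5000 * sqrt \<bar>t - s\<bar> \<le> norm (helix t - helix s)"
    and "norm (helix t - helix s) \<le> 40 * sqrt \<bar>t - s\<bar>"
proof -
  obtain m where "(1/20) / \<bar>t - s\<bar> < 10000 ^ m"
    using real_arch_pow[of 10000] by auto
  then have ex: "1/20 \<le> 10000 ^ m * \<bar>t - s\<bar>"
    using assms by (simp add: field_simps)
  define n where "n = (LEAST m. 1/20 \<le> 10000 ^ m * \<bar>t - s\<bar>)"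
  have lo: "1/20 \<le> 10000 ^ n * \<bar>t - s\<bar>"
    unfolding n_def using ex by (rule LeastI)
  have hi: "10000 ^ n * \<bar>t - s\<bar> \<le> 500"
  proof (cases n)
    case (Suc l)
    then have "\<not> 1/20 \<le> 10000 ^ l * \<bar>t - s\<bar>"
      using not_less_Least[of l "\<lambda>m. 1/20 \<le> 10000 ^ m * \<bar>t - s\<bar>"] by (simp add: n_def)
    then show ?thesis unfolding Suc power_Suc mult.assoc by linarith
  qed (use assms in simp)
  obtain e where e: "norm (helix t - helix s)
        = norm (helix (10000 ^ n * t) - helix (10000 ^ n * s) + e) / 100 ^ n"
    "norm e \<le> 27/2500 * (10000 ^ n * \<bar>t - s\<bar>)"
    "n > 0 \<longrightarrow> norm (e - (0, 1/100 * (10000 ^ n * (t - s)))) \<le> 1/1250 * (10000 ^ n * \<bar>t - s\<bar>)"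
    using helix_diff_magnify[OF hi] by blast
  have y: "10000 ^ n * \<bar>t - s\<bar> = \<bar>10000 ^ n * t - 10000 ^ n * s\<bar>"
    "10000 ^ n * (t - s) = 10000 ^ n * t - 10000 ^ n * s"
    by (simp_all add: abs_mult right_diff_distrib flip: abs_mult_pos right_diff_distrib)
  have "n = 0 \<Longrightarrow> 10000 ^ n * \<bar>t - s\<bar> \<le> 16/5"
    using assms by simp
  then have lower: "norm (helix (10000 ^ n * t) - helix (10000 ^ n * s) + e) \<ge> 1/200"
    using lo e unfolding y by (intro helix_diff_lower) auto
  have "norm (helix (10000 ^ n * t) - helix (10000 ^ n * s) + e)
      \<le> norm (helix (10000 ^ n * t)) + norm (helix (10000 ^ n * s)) + norm e"
    by (rule order_trans[OF norm_triangle_ineq add_right_mono[OF norm_triangle_ineq4]])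
  then have upper: "norm (helix (10000 ^ n * t) - helix (10000 ^ n * s) + e) \<le> 8"
    using norm_helix[of "10000 ^ n * t"] norm_helix[of "10000 ^ n * s"] e(2) hi by linarith
  have sq: "(100 ^ n * sqrt \<bar>t - s\<bar>)\<^sup>2 = 10000 ^ n * \<bar>t - s\<bar>"
    by (simp add: power_mult_distrib flip: power_mult power2_eq_square)
       (simp add: power2_eq_square power_mult mult.commute[of n 2])
  have "100 ^ n * sqrt \<bar>t - s\<bar> \<le> 25"
    by (rule power2_le_imp_le) (use hi sq in simp_all)
  moreover have "1/5 \<le> 100 ^ n * sqrt \<bar>t - s\<bar>"
    by (rule power2_le_imp_le) (use lo sq in \<open>simp_all add: power2_eq_square\<close>)
  moreover have "norm (helix t - helix s) * 100 ^ n
      = norm (helix (10000 ^ n * t) - helix (10000 ^ n * s) + e)"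
    by (simp add: e(1))
  \<comment> \<open>The constants come from 1/200 = 25/5000 and 8 = 40 * 1/5.\<close>
  moreover have "1/5000 * q * N \<le> h * N \<and> h * N \<le> 40 * q * N"
    if "N * q \<le> 25" "1/5 \<le> N * q" "h * N = k" "1/200 \<le> k" "k \<le> 8" for N q h k :: real
    using that by (simp add: mult.commute)
  ultimately have "1/5000 * sqrt \<bar>t - s\<bar> * 100 ^ n \<le> norm (helix t - helix s) * 100 ^ n"
    "norm (helix t - helix s) * 100 ^ n \<le> 40 * sqrt \<bar>t - s\<bar> * 100 ^ n"
    using lower upper by blast+
  then show "1/5000 * sqrt \<bar>t - s\<bar> \<le> norm (helix t - helix s)"
    and "norm (helix t - helix s) \<le> 40 * sqrt \<bar>t - s\<bar>"
    by simp_all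
qed

lemma helix_snowflake:
  shows "1/5000 * sqrt \<bar>sin ((t - s) / 2)\<bar> \<le> norm (helix t - helix s)"
    and "norm (helix t - helix s) \<le> 80 * sqrt \<bar>sin ((t - s) / 2)\<bar>"
proof -
  \<comment> \<open>Subtracting the nearest multiple of a full turn changes neither
    \<open>helix\<close> nor the chord, and leaves a gap of at most pi.\<close>
  define m where "m = round ((t - s) / (2 * pi))"
  define s' where "s' = s + 2 * pi * of_int m"
  have "\<bar>of_int m - (t - s) / (2 * pi)\<bar> \<le> 1 / 2"
    unfolding m_def by (rule of_int_round_abs_le)
  then have "\<bar>t - s'\<bar> \<le> pi"
    by (simp add: s'_def abs_le_iff field_simps)
  then have close: "\<bar>t - s'\<bar> \<le> 16/5"
    using pi_less_4 pi_approx by simp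
  have helix: "helix s' = helix s"
    by (simp add: s'_def helix_periodic)
  have "cis s' = cis s"
    using cis_multiple_2pi[of "of_int m"] by (simp add: s'_def flip: cis_mult)
  then have sin: "\<bar>sin ((t - s) / 2)\<bar> = \<bar>sin ((t - s') / 2)\<bar>"
    using norm_cis_diff[of t s] norm_cis_diff[of t s'] by simp
  have le: "\<bar>sin ((t - s') / 2)\<bar> \<le> \<bar>t - s'\<bar>"
    using abs_sin_x_le_abs_x[of "(t - s') / 2"] by simp
  have ge: "\<bar>t - s'\<bar> \<le> 4 * \<bar>sin ((t - s') / 2)\<bar>"
    using abs_sin_half_ge[OF close] abs_ge_zero[of "t - s'"] by argo
  have "sqrt \<bar>t - s'\<bar> \<le> 2 * sqrt \<bar>sin ((t - s') / 2)\<bar>"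
    using real_sqrt_le_mono[OF ge] by (simp add: real_sqrt_mult)
  moreover have "1/5000 * sqrt \<bar>t - s'\<bar> \<le> norm (helix t - helix s)
      \<and> norm (helix t - helix s) \<le> 40 * sqrt \<bar>t - s'\<bar>"
    using helix_snowflake_near[of t s', OF _ close] unfolding helix
    by (cases "t = s'") (simp_all flip: helix)
  moreover note real_sqrt_le_mono[OF le]
  ultimately show "1/5000 * sqrt \<bar>sin ((t - s) / 2)\<bar> \<le> norm (helix t - helix s)"
    and "norm (helix t - helix s) \<le> 80 * sqrt \<bar>sin ((t - s) / 2)\<bar>"
    unfolding sin by linarith+
qed

section \<open>Heisenberg distance in characteristic coordinates\<close>

lemma dH_polar:
  "dH (r * cos \<theta>, r * sin \<theta>, z) (r' * cos \<theta>', r' * sin \<theta>', z')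
    = \<bar>r * cos \<theta> - r' * cos \<theta>'\<bar> + \<bar>r * sin \<theta> - r' * sin \<theta>'\<bar>
      + sqrt \<bar>z - z' + r * r' * sin (\<theta>' - \<theta>) / 2\<bar>"
  by (simp add: dH_def sin_diff algebra_simps diff_divide_distrib)

lemma dH_commute: "dH a b = dH b a"
proof -
  have "\<bar>z - z' + (x * y' - x' * y) / 2\<bar> = \<bar>z' - z + (x' * y - x * y') / 2\<bar>"
    for x y z x' y' z' :: real
    by (simp add: abs_if field_simps)
  then show ?thesis
    by (cases a; cases b) (simp add: dH_def abs_minus_commute)
qed

text \<open>The angle splits into \<open>\<Delta>\<close>, the drift along a characteristic curve
  between the two radii, and \<open>\<delta>\<close>, the change of curve. The hypotheses say that
  the drift costs only a multiple of \<open>r - r'\<close>, horizontally and vertically; what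
  remains is the snowflaked angle at the smaller radius.\<close>

lemma dH_polar_estimates:
  fixes r r' z z' \<theta> \<theta>' \<delta> \<Delta> P Q :: real
  assumes r: "0 \<le> r'" "r' \<le> r" and PQ: "0 \<le> P" "0 \<le> Q"
    and angle: "\<theta>' - \<theta> = \<delta> + \<Delta>"
    and \<Delta>: "r' * \<bar>\<Delta>\<bar> \<le> P * (r - r')"
    and height: "\<bar>z - z' + r * r' * sin \<Delta> / 2\<bar> \<le> Q * (r - r')\<^sup>2"
  defines "d \<equiv> dH (r * cos \<theta>, r * sin \<theta>, z) (r' * cos \<theta>', r' * sin \<theta>', z')"
  shows "r - r' \<le> d"
    and "r' * sqrt \<bar>sin (\<delta> / 2)\<bar> \<le> (2 + P + Q) * d"
    and "d \<le> (5 + 2 * P + Q) * (r - r' + r' * sqrt \<bar>sin (\<delta> / 2)\<bar>)"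
proof -
  \<comment> \<open>\<open>W\<close> and \<open>\<tau>\<close> are the horizontal and vertical parts
    of the distance, \<open>D\<close> is the planar Euclidean distance, and \<open>2 * X\<close> is
    the chord at radius \<open>r'\<close> between the two directions.\<close>
  define W where "W = \<bar>r * cos \<theta> - r' * cos \<theta>'\<bar> + \<bar>r * sin \<theta> - r' * sin \<theta>'\<bar>"
  define \<tau> where "\<tau> = z - z' + r * r' * sin (\<theta>' - \<theta>) / 2"
  define \<sigma> where "\<sigma> = \<bar>sin (\<delta> / 2)\<bar>"
  define D where "D = norm (r *\<^sub>R cis \<theta> - r' *\<^sub>R cis \<theta>')"
  define X where "X = r' * \<bar>sin ((\<delta> + \<Delta>) / 2)\<bar>"
  have d: "d = W + sqrt \<bar>\<tau>\<bar>"
    by (simp add: d_def dH_polar W_def \<tau>_def)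
  have W0: "0 \<le> W" and \<sigma>: "0 \<le> \<sigma>" "\<sigma> \<le> 1"
    by (simp_all add: W_def \<sigma>_def)
  have W_le: "W \<le> 2 * D"
    using abs_Re_le_cmod[of "r *\<^sub>R cis \<theta> - r' *\<^sub>R cis \<theta>'"] abs_Im_le_cmod[of "r *\<^sub>R cis \<theta> - r' *\<^sub>R cis \<theta>'"]
    by (simp add: W_def D_def)
  have D_le: "D \<le> W"
    using cmod_le[of "r *\<^sub>R cis \<theta> - r' *\<^sub>R cis \<theta>'"] by (simp add: W_def D_def)
  have rD: "r - r' \<le> D"
    using norm_triangle_ineq2[of "r *\<^sub>R cis \<theta>" "r' *\<^sub>R cis \<theta>'"] r by (simp add: D_def)
  then show rd: "r - r' \<le> d"
    using D_le d by (smt (verit) real_sqrt_ge_zero abs_ge_zero)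
  have rX: "2 * X = norm (r' *\<^sub>R cis \<theta> - r' *\<^sub>R cis \<theta>')"
  proof -
    have "\<bar>sin ((\<theta> - \<theta>') / 2)\<bar> = \<bar>sin ((\<delta> + \<Delta>) / 2)\<bar>"
      by (metis abs_minus_cancel angle minus_diff_eq minus_divide_left sin_minus)
    then show ?thesis
      using r by (simp add: X_def norm_cis_diff flip: scaleR_diff_right)
  qed
  have "2 * X \<le> D + (r - r')"
  proof -
    have "r' *\<^sub>R cis \<theta> - r' *\<^sub>R cis \<theta>' = (r *\<^sub>R cis \<theta> - r' *\<^sub>R cis \<theta>') - (r - r') *\<^sub>R cis \<theta>"
      by (simp add: algebra_simps)
    then have "2 * X \<le> D + norm ((r - r') *\<^sub>R cis \<theta>)"
      unfolding rX D_def by (simp only: norm_triangle_ineq4)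
    then show ?thesis using r by simp
  qed
  then have X: "X \<le> d"
    using rD D_le d by (smt (verit) real_sqrt_ge_zero abs_ge_zero)
  have D_upper: "D \<le> (r - r') + 2 * X"
  proof -
    have "r *\<^sub>R cis \<theta> - r' *\<^sub>R cis \<theta>' = (r - r') *\<^sub>R cis \<theta> + (r' *\<^sub>R cis \<theta> - r' *\<^sub>R cis \<theta>')"
      by (simp add: algebra_simps)
    then have "D \<le> norm ((r - r') *\<^sub>R cis \<theta>) + 2 * X"
      unfolding rX D_def by (simp only: norm_triangle_ineq)
    then show ?thesis using r by simp
  qed
  have sin_add_le: "\<bar>sin (a + b)\<bar> \<le> \<bar>sin a\<bar> + \<bar>b\<bar>" for a b :: real
  proof -
    have "\<bar>sin (a + b)\<bar> \<le> \<bar>sin a\<bar> * \<bar>cos b\<bar> + \<bar>cos a\<bar> * \<bar>sin b\<bar>"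
      unfolding sin_add abs_mult[symmetric] by (rule abs_triangle_ineq)
    also have "\<dots> \<le> \<bar>sin a\<bar> * 1 + 1 * \<bar>b\<bar>"
      by (intro add_mono mult_mono abs_sin_x_le_abs_x) auto
    finally show ?thesis by simp
  qed
  \<comment> \<open>Sum-to-product separates the height error of the drift from the area swept by
    \<open>\<delta>\<close>.\<close>
  have \<tau>_eq: "\<tau> = (z - z' + r * r' * sin \<Delta> / 2) + r * r' * (sin (\<delta> / 2) * cos (\<delta> / 2 + \<Delta>))"
  proof -
    have "sin (\<delta> + \<Delta>) - sin \<Delta> = 2 * (sin (\<delta> / 2) * cos (\<delta> / 2 + \<Delta>))"
      by (simp add: sin_diff_sin add_divide_distrib add.commute)
    then have "r * r' * sin (\<delta> + \<Delta>) / 2 = r * r' * sin \<Delta> / 2 + r * r' * (sin (\<delta> / 2) * cos (\<delta> / 2 + \<Delta>))"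
      by (simp add: algebra_simps)
    then show ?thesis by (simp add: \<tau>_def angle)
  qed
  have rr: "r' * r' \<le> r * r'"
    using r by (intro mult_right_mono)

  show "r' * sqrt \<bar>sin (\<delta> / 2)\<bar> \<le> (2 + P + Q) * d"
  proof -
    \<comment> \<open>Where \<open>?c\<close> is small, the vertical part does not see
      \<open>\<delta>\<close>; but then \<open>?s\<close> is close to 1 in absolute value, and the
      chord \<open>X\<close> together with the drift bounds \<open>r'\<close>. The two regimes are
      joined by 1 \<le> |\<open>?c\<close>| + \<open>?s\<close>^2.\<close>
    let ?c = "cos (\<delta> / 2 + \<Delta>)" and ?s = "sin (\<delta> / 2 + \<Delta>)"
    have d0: "0 \<le> d" using rd r by simp
    have rd2: "(r - r')\<^sup>2 \<le> d\<^sup>2" using rd r by (intro power_mono) auto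
    have "sqrt \<bar>\<tau>\<bar> \<le> d" using d W0 by simp
    then have \<tau>: "\<bar>\<tau>\<bar> \<le> d\<^sup>2" by (rule sqrt_le_D)
    have "r'\<^sup>2 * \<sigma> * \<bar>?c\<bar> \<le> r * r' * (\<sigma> * \<bar>?c\<bar>)"
      unfolding power2_eq_square mult.assoc[of _ \<sigma>] by (rule mult_right_mono[OF rr]) (use \<sigma> in simp)
    also have "\<dots> = \<bar>r * r' * (sin (\<delta> / 2) * ?c)\<bar>"
      using r by (simp add: \<sigma>_def abs_mult)
    also have "\<dots> \<le> \<bar>\<tau>\<bar> + \<bar>z - z' + r * r' * sin \<Delta> / 2\<bar>"
      unfolding \<tau>_eq by (rule order_trans[OF _ abs_triangle_ineq4]) simp
    also have "\<dots> \<le> d\<^sup>2 + Q * d\<^sup>2"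
      using \<tau> height mult_left_mono[OF rd2 PQ(2)] by linarith
    finally have c: "r'\<^sup>2 * \<sigma> * \<bar>?c\<bar> \<le> (1 + Q) * d\<^sup>2"
      by (simp add: algebra_simps)
    have "\<bar>?s\<bar> \<le> \<bar>sin ((\<delta> + \<Delta>) / 2)\<bar> + \<bar>\<Delta>\<bar>"
      using sin_add_le[of "(\<delta> + \<Delta>) / 2" "\<Delta> / 2"] by (simp add: field_simps)
    then have "r' * \<bar>?s\<bar> \<le> X + r' * \<bar>\<Delta>\<bar>"
      unfolding X_def distrib_left[symmetric] using r(1) by (rule mult_left_mono)
    also have "\<dots> \<le> d + P * d"
      using X \<Delta> mult_left_mono[OF rd PQ(1)] by linarith
    finally have "r' * \<bar>?s\<bar> \<le> (1 + P) * d" by (simp add: algebra_simps)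
    then have "(r' * \<bar>?s\<bar>)\<^sup>2 \<le> ((1 + P) * d)\<^sup>2"
      using r by (intro power_mono) auto
    then have s: "r'\<^sup>2 * ?s\<^sup>2 \<le> (1 + P)\<^sup>2 * d\<^sup>2"
      by (simp add: power_mult_distrib)
    have "?c\<^sup>2 \<le> \<bar>?c\<bar>"
      using mult_left_mono[OF abs_cos_le_one[of "\<delta> / 2 + \<Delta>"], of "\<bar>?c\<bar>"] by (simp add: power2_eq_square)
    then have "1 \<le> \<bar>?c\<bar> + ?s\<^sup>2"
      using sin_cos_squared_add[of "\<delta> / 2 + \<Delta>"] by linarith
    moreover have "\<sigma> * ?s\<^sup>2 \<le> 1 * ?s\<^sup>2"
      using \<sigma> by (intro mult_right_mono) auto
    ultimately have "\<sigma> \<le> \<sigma> * \<bar>?c\<bar> + ?s\<^sup>2"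
      using mult_left_mono[of 1 "\<bar>?c\<bar> + ?s\<^sup>2" \<sigma>] \<sigma> by (simp add: distrib_left)
    then have "r'\<^sup>2 * \<sigma> \<le> r'\<^sup>2 * (\<sigma> * \<bar>?c\<bar> + ?s\<^sup>2)"
      by (intro mult_left_mono) auto
    also have "\<dots> = r'\<^sup>2 * \<sigma> * \<bar>?c\<bar> + r'\<^sup>2 * ?s\<^sup>2"
      by (simp add: algebra_simps)
    also have "\<dots> \<le> (1 + Q) * d\<^sup>2 + (1 + P)\<^sup>2 * d\<^sup>2"
      using c s by linarith
    also have "\<dots> = (1 + Q + (1 + P)\<^sup>2) * d\<^sup>2"
      by (simp add: algebra_simps)
    also have "\<dots> \<le> (2 + P + Q)\<^sup>2 * d\<^sup>2"
    proof (rule mult_right_mono)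
      show "1 + Q + (1 + P)\<^sup>2 \<le> (2 + P + Q)\<^sup>2"
        using PQ mult_nonneg_nonneg[OF PQ] by (simp add: power2_eq_square algebra_simps)
    qed simp
    finally have "(r' * sqrt \<sigma>)\<^sup>2 \<le> ((2 + P + Q) * d)\<^sup>2"
      unfolding power_mult_distrib real_sqrt_pow2[OF \<sigma>(1)] .
    then have "r' * sqrt \<sigma> \<le> (2 + P + Q) * d"
      by (rule power2_le_imp_le) (use d0 PQ in simp)
    then show ?thesis
      by (simp only: \<sigma>_def)
  qed

  show "d \<le> (5 + 2 * P + Q) * (r - r' + r' * sqrt \<bar>sin (\<delta> / 2)\<bar>)"
  proof -
    define S where "S = sqrt \<sigma>"
    have S: "0 \<le> S" "S \<le> 1" "S\<^sup>2 = \<sigma>"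
      using \<sigma> by (simp_all add: S_def)
    then have \<sigma>_le: "\<sigma> \<le> S"
      using mult_left_le[of S S] by (simp add: power2_eq_square)
    have "\<bar>sin ((\<delta> + \<Delta>) / 2)\<bar> \<le> \<sigma> + \<bar>\<Delta>\<bar> / 2"
      using sin_add_le[of "\<delta> / 2" "\<Delta> / 2"] by (simp add: \<sigma>_def add_divide_distrib)
    then have "X \<le> r' * (S + \<bar>\<Delta>\<bar> / 2)"
      unfolding X_def using r \<sigma>_le by (intro mult_left_mono) auto
    then have "2 * X \<le> 2 * (r' * S) + P * (r - r')"
      using \<Delta> by (simp add: algebra_simps)
    then have W: "W \<le> (2 + 2 * P) * (r - r') + 4 * (r' * S)"
      using W_le D_upper by (simp add: algebra_simps)
    \<comment> \<open>\<open>r' + (r - r') / 2\<close> is the mean of the radii, whose square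
      dominates \<open>r * r'\<close>. Bounding by a perfect square makes the root linear.\<close>
    have "\<bar>\<tau>\<bar> \<le> ((1 + Q) * (r - r') + (r' + (r - r') / 2) * S)\<^sup>2"
    proof -
      have "\<bar>sin (\<delta> / 2) * cos (\<delta> / 2 + \<Delta>)\<bar> \<le> \<sigma> * 1"
        unfolding abs_mult \<sigma>_def by (intro mult_left_mono) auto
      then have "\<bar>r * r' * (sin (\<delta> / 2) * cos (\<delta> / 2 + \<Delta>))\<bar> \<le> r * r' * \<sigma>"
        unfolding abs_mult[of "r * r'"] using r by (simp add: mult_left_mono)
      then have "\<bar>\<tau>\<bar> \<le> Q * (r - r')\<^sup>2 + r * r' * \<sigma>"
        unfolding \<tau>_eq using height by linarith
      also have "Q * (r - r')\<^sup>2 \<le> (1 + Q)\<^sup>2 * (r - r')\<^sup>2"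
        using PQ by (intro mult_right_mono zero_le_power2) (simp add: power2_eq_square algebra_simps)
      also have "r * r' * \<sigma> \<le> (r' + (r - r') / 2)\<^sup>2 * \<sigma>"
      proof (rule mult_right_mono)
        have "(r' + (r - r') / 2)\<^sup>2 - r * r' = ((r - r') / 2)\<^sup>2"
          by (simp add: power2_eq_square field_simps)
        then show "r * r' \<le> (r' + (r - r') / 2)\<^sup>2"
          by (smt (verit) zero_le_power2)
      qed (use \<sigma> in simp)
      also have "(1 + Q)\<^sup>2 * (r - r')\<^sup>2 + (r' + (r - r') / 2)\<^sup>2 * \<sigma>
          = ((1 + Q) * (r - r'))\<^sup>2 + ((r' + (r - r') / 2) * S)\<^sup>2"
        by (simp add: power_mult_distrib S)
      also have "\<dots> \<le> ((1 + Q) * (r - r') + (r' + (r - r') / 2) * S)\<^sup>2"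
        using r PQ S by (simp add: power2_sum)
      finally show ?thesis by simp
    qed
    then have "sqrt \<bar>\<tau>\<bar> \<le> (1 + Q) * (r - r') + (r' + (r - r') / 2) * S"
      using r PQ S by (intro real_le_lsqrt) auto
    moreover have "(r - r') / 2 * S \<le> (r - r') / 2"
      using r S by (simp add: mult_left_le)
    ultimately have "d \<le> ((2 + 2 * P) * (r - r') + 4 * (r' * S)) + ((1 + Q) * (r - r') + r' * S + (r - r') / 2)"
      using W unfolding d distrib_right[of r' _ S] by linarith
    also have "\<dots> = (5 + 2 * P + Q) * (r - r') + 5 * (r' * S) - 3/2 * (r - r')"
      by (simp add: field_simps)
    also have "\<dots> \<le> (5 + 2 * P + Q) * (r - r') + 5 * (r' * S)"
      using r by simp
    also have "\<dots> \<le> (5 + 2 * P + Q) * (r - r') + (5 + 2 * P + Q) * (r' * S)"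
      using r PQ S by (intro add_left_mono mult_right_mono) auto
    finally show ?thesis
      by (simp add: S_def \<sigma>_def distrib_left)
  qed
qed

text \<open>Supplies the drift and height bounds with P = 2N and Q = 2N + 2N^2. Both are mean value
  arguments: the slope of \<open>g\<close> at t is at most 2N/t, and the height error vanishes at
  \<open>r'\<close> with a derivative of order \<open>s - r'\<close>, which integrates to a
  quadratic bound.\<close>

lemma characteristic_estimates:
  fixes F F' g :: "real \<Rightarrow> real"
  assumes F: "\<And>t. t \<ge> 0 \<Longrightarrow> (F has_real_derivative F' t) (at t within {0..})"
    and bound: "\<And>t. 0 < t \<Longrightarrow> t < \<epsilon> \<Longrightarrow> \<bar>F' t\<bar> \<le> N * t"
    and g: "\<And>t. 0 < t \<Longrightarrow> (g has_real_derivative 2 * F' t / t\<^sup>2) (at t)"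
    and N: "0 \<le> N" and r: "0 \<le> r'" "r' \<le> r" "r < \<epsilon>"
  shows "r' * \<bar>g r' - g r\<bar> \<le> 2 * N * (r - r')"
    and "\<bar>F r - F r' + r * r' * sin (g r' - g r) / 2\<bar> \<le> (2 * N + 2 * N\<^sup>2) * (r - r')\<^sup>2"
proof -
  have F_at: "(F has_real_derivative F' t) (at t)" if "0 < t" for t
    using F[of t] that at_within_interior[of t "{0..}"] by (simp add: interior_real_atLeast)
  have g_le: "r' * \<bar>g r' - g s\<bar> \<le> 2 * N * (s - r')" if s: "r' \<le> s" "s < \<epsilon>" for s
  proof (cases "0 < r' \<and> r' < s")
    case True
    then obtain \<xi> where \<xi>: "r' < \<xi>" "\<xi> < s" "g s - g r' = (s - r') * (2 * F' \<xi> / \<xi>\<^sup>2)"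
      using MVT2[of r' s g "\<lambda>t. 2 * F' t / t\<^sup>2"] g by auto
    have "r' * \<bar>2 * F' \<xi> / \<xi>\<^sup>2\<bar> \<le> \<xi> * \<bar>2 * F' \<xi> / \<xi>\<^sup>2\<bar>"
      using \<xi> by (intro mult_right_mono) auto
    also have "\<dots> = 2 * (\<bar>F' \<xi>\<bar> / \<xi>)"
      using \<xi> True by (simp add: abs_mult power2_eq_square)
    also have "\<bar>F' \<xi>\<bar> / \<xi> \<le> N"
      using bound[of \<xi>] \<xi> True s by (simp add: pos_divide_le_eq)
    finally have "r' * \<bar>2 * F' \<xi> / \<xi>\<^sup>2\<bar> * (s - r') \<le> 2 * N * (s - r')"
      using \<xi> by (intro mult_right_mono) auto
    moreover have "\<bar>g r' - g s\<bar> = (s - r') * \<bar>2 * F' \<xi> / \<xi>\<^sup>2\<bar>"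
      using \<xi> by (simp only: abs_minus_commute[of "g r'"] \<xi>(3) abs_mult)
    ultimately show ?thesis by (simp add: mult_ac)
  next
    case False
    then have "r' = 0 \<or> s = r'" using s r by auto
    then show ?thesis using N s by auto
  qed
  then show "r' * \<bar>g r' - g r\<bar> \<le> 2 * N * (r - r')"
    using r by simp
  show "\<bar>F r - F r' + r * r' * sin (g r' - g r) / 2\<bar> \<le> (2 * N + 2 * N\<^sup>2) * (r - r')\<^sup>2"
  proof (cases "r' < r")
    case True
    define T where "T s = F s - F r' + s * r' * sin (g r' - g s) / 2" for s
    define T' where "T' s = F' s + (r' * sin (g r' - g s) - s * r' * (cos (g r' - g s) * (2 * F' s / s\<^sup>2))) / 2" for s
    have "continuous_on {r'..r} F"
      by (rule continuous_on_subset[OF DERIV_continuous_on[of "{0..}" F F']]) (use F r in auto)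
    moreover have "continuous_on {r'..r} (\<lambda>s. s * r' * sin (g r' - g s) / 2)"
    \<comment> \<open>\<open>g\<close> is only controlled on the open half-line; for
      \<open>r' = 0\<close> the factor \<open>r'\<close> kills the term.\<close>
    proof (cases "r' = 0")
      case False
      then have "continuous_on {r'..r} g"
        using r g by (intro continuous_at_imp_continuous_on) (auto intro!: DERIV_isCont[OF g])
      then show ?thesis by (intro continuous_intros) auto
    qed simp
    ultimately have "continuous_on {r'..r} T"
      unfolding T_def by (intro continuous_on_add continuous_on_diff continuous_on_const)
    moreover have "(T has_real_derivative T' s) (at s)" if "r' < s" for s
    proof -
      have "0 < s" using that r by simp
      then show ?thesis
        unfolding T_def T'_def
        by (auto intro!: derivative_eq_intros F_at g simp: field_simps)
    qed
    ultimately obtain \<xi> where \<xi>: "r' < \<xi>" "\<xi> < r" "T r - T r' = (r - r') * T' \<xi>"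
      using MVT[OF True, of T] by (metis DERIV_unique real_differentiable_def)
    let ?\<Delta> = "g r' - g \<xi>" and ?k = "F' \<xi> / \<xi>"
    have \<xi>0: "0 < \<xi>" "\<xi> < \<epsilon>" using \<xi> r by auto
    have k: "\<bar>?k\<bar> \<le> N"
      using bound[of \<xi>] \<xi>0 by (simp add: pos_divide_le_eq)
    have rg: "r' * \<bar>?\<Delta>\<bar> \<le> 2 * N * (\<xi> - r')"
      using g_le[of \<xi>] \<xi> \<xi>0 by simp
    \<comment> \<open>The choice of \<open>g\<close> cancels the leading part of
      \<open>F' \<xi>\<close>: what is left carries the factor \<open>\<xi> - r'\<close> or is
      controlled by the drift.\<close>
    have T': "T' \<xi> = ?k * ((\<xi> - r') + r' * (1 - cos ?\<Delta>)) + r' * sin ?\<Delta> / 2"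
      using \<xi>0 by (simp add: T'_def power2_eq_square field_simps)
    have "\<bar>r' * sin ?\<Delta>\<bar> \<le> r' * \<bar>?\<Delta>\<bar>"
      unfolding abs_mult using r by (simp add: mult_left_mono abs_sin_x_le_abs_x)
    moreover have "\<bar>1 - cos ?\<Delta>\<bar> \<le> \<bar>?\<Delta>\<bar>"
      using abs_Re_le_cmod[of "cis 0 - cis ?\<Delta>"] norm_cis_diff_le[of 0 ?\<Delta>] by simp
    then have "\<bar>r' * (1 - cos ?\<Delta>)\<bar> \<le> r' * \<bar>?\<Delta>\<bar>"
      unfolding abs_mult using r by (simp add: mult_left_mono)
    then have "\<bar>(\<xi> - r') + r' * (1 - cos ?\<Delta>)\<bar> \<le> (1 + 2 * N) * (\<xi> - r')"
      using rg \<xi> by (simp add: algebra_simps)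
    then have "\<bar>?k * ((\<xi> - r') + r' * (1 - cos ?\<Delta>))\<bar> \<le> N * ((1 + 2 * N) * (\<xi> - r'))"
      unfolding abs_mult by (intro mult_mono k N) auto
    ultimately have "\<bar>T' \<xi>\<bar> \<le> N * ((1 + 2 * N) * (\<xi> - r')) + N * (\<xi> - r')"
      unfolding T' using rg by linarith
    also have "\<dots> = (2 * N + 2 * N\<^sup>2) * (\<xi> - r')"
      by (simp add: power2_eq_square algebra_simps)
    also have "\<dots> \<le> (2 * N + 2 * N\<^sup>2) * (r - r')"
      using \<xi> N by (intro mult_left_mono) auto
    finally have "\<bar>T' \<xi>\<bar> * (r - r') \<le> (2 * N + 2 * N\<^sup>2) * (r - r') * (r - r')"
      using True by (intro mult_right_mono) auto
    moreover have "T r' = 0" by (simp add: T_def)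
    ultimately have "\<bar>T r\<bar> \<le> (2 * N + 2 * N\<^sup>2) * (r - r')\<^sup>2"
      using \<xi>(3) True by (simp add: abs_mult power2_eq_square mult_ac)
    then show ?thesis by (simp add: T_def)
  qed (use r in simp)
qed

text \<open>The antiderivative lives on the open half-line because it may diverge at 0:
  \<open>F' t = t\<close> gives 2 log t.\<close>

lemma characteristic_angle:
  fixes F' :: "real \<Rightarrow> real"
  assumes "continuous_on {0<..} F'"
  obtains g where "\<And>t. 0 < t \<Longrightarrow> (g has_real_derivative 2 * F' t / t\<^sup>2) (at t)"
proof -
  have "isCont (\<lambda>t. 2 * F' t / t\<^sup>2) t" if "0 < t" for t
    using assms that by (intro continuous_intros) (auto simp: continuous_on_eq_continuous_at)
  then obtain g where "\<forall>t. ereal 0 < ereal t \<longrightarrow> ereal t < \<infinity> \<longrightarrow>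
      (g has_vector_derivative 2 * F' t / t\<^sup>2) (at t)"
    using einterval_antiderivative[of "ereal 0" "\<infinity>" "\<lambda>t. 2 * F' t / t\<^sup>2"] by auto
  then show thesis
    by (intro that[of g]) (simp add: has_real_derivative_iff_has_vector_derivative)
qed

section \<open>The cone over the snowflaked circle\<close>

definition cone_point :: "real \<Rightarrow> complex \<times> real \<Rightarrow> real ^ 4" where
  "cone_point r p = (\<chi> i. if i = 1 then r else if i = 2 then r * Re (fst p) else if i = 3 then r * Im (fst p) else r * snd p)"

lemma dist_cone_point: "dist (cone_point r p) (cone_point r' q) = norm (r - r', r *\<^sub>R p - r' *\<^sub>R q)"
proof -
  have "(dist (cone_point r p) (cone_point r' q))\<^sup>2 = (norm (r - r', r *\<^sub>R p - r' *\<^sub>R q))\<^sup>2"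
    by (cases p; cases q)
       (simp add: cone_point_def dist_vec_def L2_set_def sum_4 dist_real_def norm_Pair cmod_power2 sum_nonneg)
  then show ?thesis by simp
qed

text \<open>The helix has norm below 2, so changing the radius at fixed angle costs at most a
  multiple of \<open>r - r'\<close>; at the common radius \<open>r'\<close> the square-root law
  applies.\<close>

lemma dist_cone_helix:
  fixes r r' \<phi> \<phi>' :: real
  assumes r: "0 \<le> r'" "r' \<le> r"
  defines "X \<equiv> dist (cone_point r (helix \<phi>)) (cone_point r' (helix \<phi>'))"
    and "Z \<equiv> r' * sqrt \<bar>sin ((\<phi>' - \<phi>) / 2)\<bar>"
  shows "r - r' \<le> X" and "Z \<le> 15000 * X" and "X \<le> 3 * (r - r') + 80 * Z"
proof -
  define D where "D = r *\<^sub>R helix \<phi> - r' *\<^sub>R helix \<phi>'"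
  define Y where "Y = norm (r' *\<^sub>R helix \<phi>' - r' *\<^sub>R helix \<phi>)"
  have Y: "Y = r' * norm (helix \<phi>' - helix \<phi>)"
    using r by (simp add: Y_def flip: scaleR_diff_right)
  have ZY: "Z \<le> 5000 * Y" "Y \<le> 80 * Z"
    using helix_snowflake[of \<phi>' \<phi>, THEN mult_left_mono, OF r(1)] by (simp_all add: Y Z_def)
  have X: "X = norm (r - r', D)"
    by (simp add: X_def D_def dist_cone_point)
  have step: "norm ((r - r') *\<^sub>R helix \<phi>) \<le> 2 * (r - r')"
    using mult_left_mono[OF norm_helix[of \<phi>], of "r - r'"] r by simp
  show rX: "r - r' \<le> X"
    unfolding X using norm_fst_le[of "r - r'" D] by simp
  have "D = (r - r') *\<^sub>R helix \<phi> - (r' *\<^sub>R helix \<phi>' - r' *\<^sub>R helix \<phi>)"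
    by (simp add: D_def algebra_simps)
  then have DY: "norm D \<le> 2 * (r - r') + Y"
    using step norm_triangle_ineq4[of "(r - r') *\<^sub>R helix \<phi>" "r' *\<^sub>R helix \<phi>' - r' *\<^sub>R helix \<phi>"]
    by (simp add: Y_def)
  have "r' *\<^sub>R helix \<phi>' - r' *\<^sub>R helix \<phi> = (r - r') *\<^sub>R helix \<phi> - D"
    by (simp add: D_def algebra_simps)
  then have "Y \<le> 2 * (r - r') + norm D"
    using step norm_triangle_ineq4[of "(r - r') *\<^sub>R helix \<phi>" D] by (simp add: Y_def)
  moreover have "norm D \<le> X"
    unfolding X using norm_snd_le[of D "r - r'"] by simp
  ultimately show "Z \<le> 15000 * X"
    using ZY rX by argo
  have "X \<le> norm (r - r') + norm D"
    unfolding X by (rule norm_Pair_le)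
  then show "X \<le> 3 * (r - r') + 80 * Z"
    using DY ZY r by simp
qed

section \<open>Assembling the embedding of the surface\<close>

lemma polar_representation:
  obtains \<theta> where "sqrt (x\<^sup>2 + y\<^sup>2) * cos \<theta> = x" "sqrt (x\<^sup>2 + y\<^sup>2) * sin \<theta> = y"
proof
  let ?z = "Complex x y"
  have polar: "rcis (cmod ?z) (Arg ?z) = ?z"
    by (rule rcis_cmod_Arg)
  show "sqrt (x\<^sup>2 + y\<^sup>2) * cos (Arg ?z) = x"
    using arg_cong[OF polar, of Re] by (simp only: Re_rcis complex.sel complex_norm)
  show "sqrt (x\<^sup>2 + y\<^sup>2) * sin (Arg ?z) = y"
    using arg_cong[OF polar, of Im] by (simp only: Im_rcis complex.sel complex_norm)
qed

text \<open>Heisenberg distance and image distance are both comparable to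
  \<open>?r - ?r' + ?Z\<close>, radial gap plus snowflaked angle, hence to each other.\<close>

lemma biLip_embeds_radial_graph:
  fixes F F' :: "real \<Rightarrow> real"
  assumes F: "\<And>t. t \<ge> 0 \<Longrightarrow> (F has_real_derivative F' t) (at t within {0..})"
    and cont: "continuous_on {0<..} F'"
    and bound: "\<And>t. 0 < t \<Longrightarrow> t < \<epsilon> \<Longrightarrow> \<bar>F' t\<bar> \<le> N * t"
    and N: "0 \<le> N"
    and A: "A \<subseteq> {(x, y, F (sqrt (x\<^sup>2 + y\<^sup>2))) | x y. sqrt (x\<^sup>2 + y\<^sup>2) < \<epsilon>}"
  shows "biLip_embeds_R4 A (20000 * (5 + 6 * N + 2 * N\<^sup>2))"
proof -
  \<comment> \<open>This is 5 + 2P + Q for P = 2N and Q = 2N + 2N^2; it also dominates 2 + P +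
    Q.\<close>
  define C where "C = 5 + 6 * N + 2 * N\<^sup>2"
  have C: "5 \<le> C" using N by (simp add: C_def)
  obtain g where g: "\<And>t. 0 < t \<Longrightarrow> (g has_real_derivative 2 * F' t / t\<^sup>2) (at t)"
    using characteristic_angle[OF cont] by blast
  define R where "R x y = sqrt (x\<^sup>2 + y\<^sup>2)" for x y :: real
  have "\<forall>x y. \<exists>\<theta>. R x y * cos \<theta> = x \<and> R x y * sin \<theta> = y"
    unfolding R_def by (meson polar_representation)
  then obtain \<theta> where \<theta>: "\<And>x y. R x y * cos (\<theta> x y) = x" "\<And>x y. R x y * sin (\<theta> x y) = y"
    by metis
  \<comment> \<open>\<open>\<theta> - g r\<close> is the characteristic coordinate. At the origin
    any choice of angle is harmless, since the cone collapses there.\<close>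
  define f where "f = (\<lambda>(x, y, z :: real). cone_point (R x y) (helix (\<theta> x y - g (R x y))))"
  \<comment> \<open>The estimates require the second radius to be the smaller one; the other order
    follows by symmetry of both distances.\<close>
  have ordered: "dist (f (x, y, F (R x y))) (f (x', y', F (R x' y')))
        \<le> 20000 * C * dH (x, y, F (R x y)) (x', y', F (R x' y'))
      \<and> dH (x, y, F (R x y)) (x', y', F (R x' y'))
        \<le> 20000 * C * dist (f (x, y, F (R x y))) (f (x', y', F (R x' y')))"
    if le: "R x' y' \<le> R x y" and lt: "R x y < \<epsilon>" for x y x' y'
  proof -
    let ?r = "R x y" and ?r' = "R x' y'"
    let ?\<phi> = "\<theta> x y - g ?r" and ?\<phi>' = "\<theta> x' y' - g ?r'"
    let ?d = "dH (x, y, F ?r) (x', y', F ?r')" and ?X = "dist (f (x, y, F ?r)) (f (x', y', F ?r'))"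
    let ?Z = "?r' * sqrt \<bar>sin ((?\<phi>' - ?\<phi>) / 2)\<bar>"
    have r': "0 \<le> ?r'" by (simp add: R_def)
    have angle: "\<theta> x' y' - \<theta> x y = (?\<phi>' - ?\<phi>) + (g ?r' - g ?r)" by simp
    have PQ: "0 \<le> 2 * N" "0 \<le> 2 * N + 2 * N\<^sup>2" using N by simp_all
    note est = dH_polar_estimates[OF r' le PQ angle
        characteristic_estimates[OF F bound g N r' le lt], unfolded \<theta>]
    have d: "?r - ?r' \<le> ?d" "?Z \<le> C * ?d" "?d \<le> C * (?r - ?r' + ?Z)"
    proof -
      have "0 \<le> ?d" using est(1) le by simp
      then have "(2 + 2 * N + (2 * N + 2 * N\<^sup>2)) * ?d \<le> C * ?d"
        using N by (intro mult_right_mono) (simp_all add: C_def)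
      then show "?Z \<le> C * ?d" using est(2) by linarith
      show "?d \<le> C * (?r - ?r' + ?Z)"
        using est(3) by (simp add: C_def algebra_simps)
    qed (rule est(1))
    have X: "?X = dist (cone_point ?r (helix ?\<phi>)) (cone_point ?r' (helix ?\<phi>'))"
      by (simp add: f_def)
    note X_est = dist_cone_helix[where \<phi> = ?\<phi> and \<phi>' = ?\<phi>', OF r' le, folded X]
    have d0: "0 \<le> ?d" and X0: "0 \<le> ?X" using d(1) le by simp_all
    have "?d \<le> C * ?d" using mult_right_mono[of 1 C ?d] C d0 by simp
    \<comment> \<open>The factor needed here is 83, and in the reverse direction 15001; 20000 covers
      both.\<close>
    moreover have "X \<le> 20000 * c" if "X \<le> 3 * u + 80 * Z" "u \<le> d" "Z \<le> c" "d \<le> c" "0 \<le> d" for X u Z c d :: real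
      using that by argo
    ultimately have "?X \<le> 20000 * (C * ?d)"
      using X_est(3) d d0 by blast
    moreover have "C * (?r - ?r' + ?Z) \<le> C * (20000 * ?X)"
      using C X_est X0 by (intro mult_left_mono) linarith+
    ultimately show ?thesis using d(3) by (simp add: mult_ac)
  qed
  have "dist (f a) (f b) \<le> 20000 * C * dH a b \<and> dH a b \<le> 20000 * C * dist (f a) (f b)"
    if "a \<in> A" and "b \<in> A" for a b
  proof -
    obtain x y x' y' where ab: "a = (x, y, F (R x y))" "b = (x', y', F (R x' y'))"
      and lt: "R x y < \<epsilon>" "R x' y' < \<epsilon>"
      using subsetD[OF A \<open>a \<in> A\<close>] subsetD[OF A \<open>b \<in> A\<close>] unfolding R_def by blast
    show ?thesis
    proof (cases "R x' y' \<le> R x y")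
      case True
      then show ?thesis unfolding ab using lt(1) by (rule ordered)
    next
      case False
      then show ?thesis
        unfolding ab using ordered[where x = x' and y = y' and x' = x and y' = y] lt by (simp add: dH_commute dist_commute)
    qed
  qed
  then show ?thesis
    unfolding biLip_embeds_R4_def C_def[symmetric] using C
    by (intro exI[of _ f] ballI) (auto simp: pos_divide_le_eq mult_ac)
qed

theorem theorem5p1:
  "\<exists>Lfun :: real \<Rightarrow> real. \<forall>(F :: real \<Rightarrow> real) (F' :: real \<Rightarrow> real).
     (\<forall>t\<ge>0. (F has_real_derivative F' t) (at t within {0..})) \<and>
     (\<exists>K. \<forall>s\<ge>0. \<forall>t\<ge>0. \<bar>F' s - F' t\<bar> \<le> K * \<bar>s - t\<bar>) \<and>
     F' 0 = 0 \<longrightarrow>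
     (let M = max 1 (real_of_ereal (Limsup (at_right 0) (\<lambda>t. ereal (\<bar>F' t\<bar> / t)))) in
       Lfun M > 1 \<and>
       (\<exists>\<epsilon>>0. \<exists>U. radial_graph F \<inter> ball (0, 0, F 0) \<epsilon> \<subseteq> U \<and> U \<subseteq> radial_graph F \<and>
            biLip_embeds_R4 U (Lfun M)))"
proof (intro exI[of _ "\<lambda>M. 20000 * (5 + 6 * (2 * M) + 2 * (2 * M)\<^sup>2)"] allI impI, elim conjE exE, unfold Let_def)
  fix F F' :: "real \<Rightarrow> real" and K
  assume F: "\<forall>t\<ge>0. (F has_real_derivative F' t) (at t within {0..})"
    and K: "\<forall>s\<ge>0. \<forall>t\<ge>0. \<bar>F' s - F' t\<bar> \<le> K * \<bar>s - t\<bar>" and F'0: "F' 0 = 0"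
  define l where "l = Limsup (at_right 0) (\<lambda>t. ereal (\<bar>F' t\<bar> / t))"
  define M where "M = max 1 (real_of_ereal l)"
  have M: "1 \<le> M" by (simp add: M_def)
  \<comment> \<open>The Lipschitz bound excludes an infinite limsup, for which
    \<open>real_of_ereal\<close> would return 0 and \<open>M\<close> would control nothing.\<close>
  have "l \<le> ereal K"
    unfolding l_def
  proof (rule Limsup_bounded)
    show "\<forall>\<^sub>F t in at_right 0. ereal (\<bar>F' t\<bar> / t) \<le> ereal K"
      using eventually_at_right_less
    proof eventually_elim
      case (elim t)
      then show ?case using K[rule_format, of t 0] F'0 by (simp add: pos_divide_le_eq)
    qed
  qed
  \<comment> \<open>Doubling \<open>M\<close> gives strict room above the limsup, so
    \<open>2 * M\<close> bounds the quotient on a whole interval next to 0 and can serve as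
    \<open>N\<close>.\<close>
  then have "l < ereal (2 * M)"
    using M by (cases l) (auto simp: M_def)
  then have "\<forall>\<^sub>F t in at_right 0. ereal (\<bar>F' t\<bar> / t) < ereal (2 * M)"
    unfolding l_def by (rule Limsup_lessD)
  then obtain \<epsilon> where \<epsilon>: "0 < \<epsilon>" "\<And>t. 0 < t \<Longrightarrow> t < \<epsilon> \<Longrightarrow> \<bar>F' t\<bar> / t < 2 * M"
    unfolding eventually_at_right_field by auto
  let ?U = "radial_graph F \<inter> ball (0, 0, F 0) \<epsilon>"
  have "K-lipschitz_on {0<..} F'"
    if "0 \<le> K" using K that by (intro lipschitz_onI) (auto simp: dist_real_def)
  moreover have "0 \<le> K"
    using K[rule_format, of 1 0] by simp
  ultimately have cont: "continuous_on {0<..} F'"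
    using lipschitz_on_continuous_on by blast
  have "?U \<subseteq> {(x, y, F (sqrt (x\<^sup>2 + y\<^sup>2))) | x y. sqrt (x\<^sup>2 + y\<^sup>2) < \<epsilon>}"
  proof
    fix w assume "w \<in> ?U"
    then obtain x y where w: "w = (x, y, F (sqrt (x\<^sup>2 + y\<^sup>2)))" and "norm (w - (0, 0, F 0)) < \<epsilon>"
      by (auto simp: radial_graph_def dist_norm norm_minus_commute)
    moreover have "sqrt (x\<^sup>2 + y\<^sup>2) \<le> norm (w - (0, 0, F 0))"
      by (simp add: w norm_Pair)
    ultimately show "w \<in> {(x, y, F (sqrt (x\<^sup>2 + y\<^sup>2))) | x y. sqrt (x\<^sup>2 + y\<^sup>2) < \<epsilon>}"
      by auto
  qed
  then have "biLip_embeds_R4 ?U (20000 * (5 + 6 * (2 * M) + 2 * (2 * M)\<^sup>2))"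
    using F cont \<epsilon>(2) M
    by (intro biLip_embeds_radial_graph[of F F' \<epsilon> "2 * M" ?U]) (force simp: pos_divide_less_eq)+
  moreover have "20000 * (5 + 6 * (2 * M) + 2 * (2 * M)\<^sup>2) > 1"
    using M by (simp add: add_pos_nonneg)
  ultimately show "1 < 20000 * (5 + 6 * (2 * max 1 (real_of_ereal (Limsup (at_right 0) (\<lambda>t. ereal (\<bar>F' t\<bar> / t)))))
        + 2 * (2 * max 1 (real_of_ereal (Limsup (at_right 0) (\<lambda>t. ereal (\<bar>F' t\<bar> / t)))))\<^sup>2)
      \<and> (\<exists>\<epsilon>>0. \<exists>U. radial_graph F \<inter> ball (0, 0, F 0) \<epsilon> \<subseteq> U \<and> U \<subseteq> radial_graph F \<and>
            biLip_embeds_R4 U (20000 * (5 + 6 * (2 * max 1 (real_of_ereal (Limsup (at_right 0) (\<lambda>t. ereal (\<bar>F' t\<bar> / t)))))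
        + 2 * (2 * max 1 (real_of_ereal (Limsup (at_right 0) (\<lambda>t. ereal (\<bar>F' t\<bar> / t)))))\<^sup>2)))"
    using \<epsilon>(1) unfolding M_def l_def by blast
qed

end
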